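(* Let $\omega$ be a gauge and let $Y$ be a separable Banach space containing an isomorphic copy of $c_0$. For every infinite-dimensional Banach space $X$, $$\frac{\omega(\kappa(X))}{\omega(1)}\leq\lambda_{\omega}(X,Y).$$
   Context: Banach spaces are real; $c_0$ is the real Banach space of null sequences with the supremum norm. $B(X)$ denotes the unit ball of $X$. Kottman constant: for an infinite-dimensional Banach space $X$, $\kappa(X):=\sup_{(x_n)\subset B(X)}\operatorname{sep}(x_n)$, the supremum being over all sequences $(x_n)_{n\in\mathbb N}$ in $B(X)$, where $\operatorname{sep}(x_n)=\inf_{n\neq m}\|x_n-x_m\|$. Gauge: a function $\omega:[0,\infty)\to[0,\infty)$ which is continuous, (strictly) increasing and subadditive, with $\lim_{t\to0}\omega(t)=0$. For metric spaces $(X,d)$, $(Y,\rho)$, a map $f:X\to Y$ is $\omega$-Lipschitz if $\operatorname{Lip}_{\omega}(f)=\sup\{\rho(f(x),f(y))/\omega(d(x,y)): x\neq y\}<\infty$. $\lambda_{\omega}(X,Y)$ is the infimum of all $\lambda>0$ such that for every subset $M$ of $X$, every $\omega$-Lipschitz map $f:M\to Y$ admits an extension $F:X\to Y$ with $\operatorname{Lip}_{\omega}(F)\leq\lambda\operatorname{Lip}_{\omega}(f)$ (with value $\infty$ if no such $\lambda$ exists). *)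

theory Defs
  imports "HOL-Analysis.Analysis"
begin

definition gauge_fun :: "(real \<Rightarrow> real) \<Rightarrow> bool" where
  "gauge_fun \<omega> \<longleftrightarrow>
     (\<forall>t\<ge>0. 0 \<le> \<omega> t) \<and>
     continuous_on {0..} \<omega> \<and>
     strict_mono_on {0..} \<omega> \<and>
     (\<forall>s\<ge>0. \<forall>t\<ge>0. \<omega> (s + t) \<le> \<omega> s + \<omega> t) \<and>
     (\<omega> \<longlongrightarrow> 0) (at_right 0)"

definition sep :: "(nat \<Rightarrow> 'a::metric_space) \<Rightarrow> real" where
  "sep x = (INF (n, m) \<in> {(n, m). n \<noteq> m}. dist (x n) (x m))"

definition kottman :: "'a::real_normed_vector itself \<Rightarrow> real" where
  "kottman (_ :: 'a itself) = (SUP x \<in> {x :: nat \<Rightarrow> 'a. range x \<subseteq> cball 0 1}. sep x)"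

lemma bdd_below_sep: "bdd_below ((\<lambda>(n, m). dist (x n) (x m)) ` {(n, m). n \<noteq> m})"
  by (rule bdd_belowI[of _ 0]) auto

lemma bdd_above_kottman:
  "bdd_above (sep ` {x :: nat \<Rightarrow> 'a::real_normed_vector. range x \<subseteq> cball 0 1})"
proof (rule bdd_aboveI2[where M = 2])
  fix x :: "nat \<Rightarrow> 'a" assume "x \<in> {x. range x \<subseteq> cball 0 1}"
  then have "norm (x n) \<le> 1" for n by (auto simp: image_subset_iff)
  then have "dist (x 0) (x 1) \<le> 2"
    using norm_triangle_ineq4[of "x 0" "x 1"] by (smt (verit) dist_norm)
  moreover have "sep x \<le> dist (x 0) (x 1)"
    unfolding sep_def using cINF_lower[OF bdd_below_sep, of "(0, 1)" x] by simp
  ultimately show "sep x \<le> 2" by simp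
qed

text \<open>
  The least \<omega>-Lipschitz constant of the restriction of \<open>f\<close> to \<open>M\<close>; it is \<open>0\<close> when \<open>M\<close> has at
  most one point, and \<open>f\<close> is \<omega>-Lipschitz on \<open>M\<close> iff it is finite.
\<close>
definition Lip_gauge ::
    "(real \<Rightarrow> real) \<Rightarrow> 'a::metric_space set \<Rightarrow> ('a \<Rightarrow> 'b::metric_space) \<Rightarrow> ennreal" where
  "Lip_gauge \<omega> M f =
     (SUP (x, y) \<in> {(x, y). x \<in> M \<and> y \<in> M \<and> x \<noteq> y}.
        ennreal (dist (f x) (f y) / \<omega> (dist x y)))"

definition lambda_gauge ::
    "(real \<Rightarrow> real) \<Rightarrow> 'a::metric_space itself \<Rightarrow> 'b::metric_space itself \<Rightarrow> ennreal" where
  "lambda_gauge \<omega> (_ :: 'a itself) (_ :: 'b itself) =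
     Inf {ennreal L |L::real. 0 < L \<and>
       (\<forall>(M :: 'a set) (f :: 'a \<Rightarrow> 'b). Lip_gauge \<omega> M f < \<infinity> \<longrightarrow>
          (\<exists>F :: 'a \<Rightarrow> 'b. (\<forall>x\<in>M. F x = f x) \<and>
             Lip_gauge \<omega> UNIV F \<le> ennreal L * Lip_gauge \<omega> M f))}"

text \<open>
  Every sequence is continuous on the discrete space \<^typ>\<open>nat\<close>, so \<^typ>\<open>nat \<Rightarrow>\<^sub>C real\<close> is the
  space of bounded real sequences with the supremum norm.
\<close>
definition c0 :: "(nat \<Rightarrow>\<^sub>C real) set" where
  "c0 = {x. apply_bcontfun x \<longlonglongrightarrow> 0}"

text \<open>
  The image \<open>T ` c0\<close> is automatically a linear subspace, and closed if the ambient space is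
  complete. Only the values of \<open>T\<close> on \<open>c0\<close> matter.
\<close>
definition contains_c0 :: "'b::real_normed_vector itself \<Rightarrow> bool" where
  "contains_c0 (_ :: 'b itself) \<longleftrightarrow>
     (\<exists>(T :: (nat \<Rightarrow>\<^sub>C real) \<Rightarrow> 'b) S.
        (\<forall>x\<in>c0. \<forall>y\<in>c0. T (x + y) = T x + T y) \<and>
        (\<forall>r. \<forall>x\<in>c0. T (r *\<^sub>R x) = r *\<^sub>R T x) \<and>
        homeomorphism c0 (T ` c0) T S)"

end

theory Submission
  imports Defs
begin

text \<open>
  Suppose the extension constant \<open>L\<close> is admissible but \<open>L * \<omega> 1 < \<omega> \<kappa>\<close>, where \<open>\<kappa>\<close> is the Kottman
  constant of \<open>X\<close>. By continuity of \<open>\<omega>\<close> there is a sequence \<open>x\<close> in the unit ball of \<open>X\<close> whose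
  terms are more than some \<open>k\<close> apart with \<open>r = L * \<omega> 1 / \<omega> k < 1\<close>. If \<open>y\<close> is any sequence of
  diameter at most \<open>1\<close> in \<open>Y\<close>, then sending \<open>x n\<close> to \<open>y n\<close> has \<open>\<omega>\<close>-Lipschitz constant at most
  \<open>1 / \<omega> k\<close>, and the value at \<open>0\<close> of an extension is a point within \<open>r\<close> of every \<open>y n\<close>, because
  \<open>0\<close> is within \<open>1\<close> of every \<open>x n\<close>. So it suffices to find in \<open>Y\<close> a sequence of diameter at most
  \<open>1\<close> such that no point of \<open>Y\<close> lies within \<open>r\<close> of all its terms.

  In \<open>c\<^sub>0\<close> itself the partial sums of the unit vector basis would do. A separable \<open>Y\<close> with an
  isomorphic copy of \<open>c\<^sub>0\<close> requires two further ideas. First, James's distortion argument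
  (\<open>james_block_sequence\<close>) replaces the basis of the copy by blocks \<open>u\<close> of norm above a given
  \<open>t < 1\<close> for which all sums with coefficients in \<open>[-1, 1]\<close> have norm at most \<open>1\<close>. Hence for every
  choice of signs the signed partial sums of \<open>u\<close> have diameter at most \<open>1\<close>. Second, some choice of
  signs leaves no point within \<open>r < t\<close> of all partial sums (\<open>separable_sign_series_no_center\<close>):
  points belonging to two different choices would be at distance more than \<open>2 * (t - r)\<close>, and a
  separable space has no uncountable uniformly separated subset. This is the only use of
  separability, and it cannot be dispensed with: Lipschitz maps into \<open>\<ell>\<^sub>\<infinity>\<close>, which also contains
  \<open>c\<^sub>0\<close>, extend without increasing the constant.
\<close>

section \<open>Gauges and the gauge Lipschitz constant\<close>

lemma gauge_fun_zero:
  assumes "gauge_fun \<omega>"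
  shows "\<omega> 0 = 0"
proof -
  have "(\<omega> \<longlongrightarrow> \<omega> 0) (at 0 within {0..})"
    using assms by (auto simp: gauge_fun_def continuous_on_def)
  then have "(\<omega> \<longlongrightarrow> \<omega> 0) (at_right 0)"
    by (rule tendsto_within_subset) auto
  then show ?thesis
    using assms tendsto_unique[OF trivial_limit_at_right_real] by (auto simp: gauge_fun_def)
qed

lemma gauge_fun_less:
  assumes "gauge_fun \<omega>" "0 \<le> s" "s < t"
  shows "\<omega> s < \<omega> t"
  using assms by (auto simp: gauge_fun_def strict_mono_on_def)

lemma gauge_fun_mono:
  assumes "gauge_fun \<omega>" "0 \<le> s" "s \<le> t"
  shows "\<omega> s \<le> \<omega> t"
  using gauge_fun_less[OF assms(1,2), of t] assms(3) by (cases "s = t") auto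

lemma gauge_fun_pos:
  assumes "gauge_fun \<omega>" "0 < t"
  shows "0 < \<omega> t"
  using gauge_fun_less[OF assms(1), of 0 t] gauge_fun_zero[OF assms(1)] assms(2) by simp

lemma Lip_gauge_le_iff:
  assumes "gauge_fun \<omega>" "0 \<le> K"
  shows "Lip_gauge \<omega> M f \<le> ennreal K \<longleftrightarrow>
           (\<forall>x\<in>M. \<forall>y\<in>M. dist (f x) (f y) \<le> K * \<omega> (dist x y))"
proof -
  have "ennreal (dist (f x) (f y) / \<omega> (dist x y)) \<le> ennreal K \<longleftrightarrow>
          dist (f x) (f y) \<le> K * \<omega> (dist x y)" if "x \<noteq> y" for x y
    using gauge_fun_pos[OF assms(1), of "dist x y"] that assms(2)
    by (simp add: ennreal_le_iff pos_divide_le_eq)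
  then have "Lip_gauge \<omega> M f \<le> ennreal K \<longleftrightarrow>
           (\<forall>x\<in>M. \<forall>y\<in>M. x \<noteq> y \<longrightarrow> dist (f x) (f y) \<le> K * \<omega> (dist x y))"
    by (auto simp: Lip_gauge_def SUP_le_iff)
  also have "\<dots> \<longleftrightarrow> (\<forall>x\<in>M. \<forall>y\<in>M. dist (f x) (f y) \<le> K * \<omega> (dist x y))"
    by (metis assms(1) dist_self gauge_fun_zero mult_zero_right order_refl)
  finally show ?thesis .
qed

section \<open>Separated sequences in the unit ball\<close>

lemma sep_le_dist: "n \<noteq> m \<Longrightarrow> sep x \<le> dist (x n) (x m)"
  unfolding sep_def using cINF_lower[OF bdd_below_sep, of "(n, m)" x] by simp

lemma kottman_nonneg: "0 \<le> kottman TYPE('x::real_normed_vector)"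
proof -
  have "{(n, m). n \<noteq> (m::nat)} \<noteq> {}"
    by (auto intro: exI[of _ 0] exI[of _ 1])
  then have "sep (\<lambda>_. 0 :: 'x) = 0"
    by (simp add: sep_def case_prod_unfold)
  moreover have "sep (\<lambda>_. 0 :: 'x) \<le> kottman TYPE('x)"
    unfolding kottman_def by (rule cSUP_upper[OF _ bdd_above_kottman]) auto
  ultimately show ?thesis by simp
qed

lemma less_kottmanE:
  assumes "k < kottman TYPE('x::real_normed_vector)"
  obtains x :: "nat \<Rightarrow> 'x::real_normed_vector"
  where "\<And>n. norm (x n) \<le> 1" "\<And>n m. n \<noteq> m \<Longrightarrow> k < dist (x n) (x m)"
proof -
  have "{x :: nat \<Rightarrow> 'x. range x \<subseteq> cball 0 1} \<noteq> {}"
    by (auto intro!: exI[of _ "\<lambda>_. 0"])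
  then obtain x :: "nat \<Rightarrow> 'x" where x: "range x \<subseteq> cball 0 1" "k < sep x"
    using assms unfolding kottman_def by (subst (asm) less_cSUP_iff[OF _ bdd_above_kottman]) auto
  show thesis
    by (rule that[of x]) (use x in \<open>auto simp: image_subset_iff intro: less_le_trans sep_le_dist\<close>)
qed

section \<open>The unit vectors of a copy of \<open>c\<^sub>0\<close>\<close>

text \<open>
  The block argument needs from the copy of \<open>c\<^sub>0\<close> only the images of the unit vectors: bounded
  below since the inverse of the isomorphism is continuous at \<open>0\<close>, with uniformly bounded
  combinations since the isomorphism is.
\<close>

lemma contains_c0_unit_vectors:
  assumes "contains_c0 TYPE('y::real_normed_vector)"
  shows "\<exists>(v :: nat \<Rightarrow> 'y) c C. 0 < c \<and> (\<forall>i. c \<le> norm (v i)) \<and>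
    (\<forall>a m n. (\<forall>i. \<bar>a i\<bar> \<le> 1) \<longrightarrow> norm (\<Sum>i=m..<n. a i *\<^sub>R v i) \<le> C)"
proof -
  obtain T :: "(nat \<Rightarrow>\<^sub>C real) \<Rightarrow> 'y" and S where
    add: "\<And>x y. x \<in> c0 \<Longrightarrow> y \<in> c0 \<Longrightarrow> T (x + y) = T x + T y" and
    scale: "\<And>r x. x \<in> c0 \<Longrightarrow> T (r *\<^sub>R x) = r *\<^sub>R T x" and
    hom: "homeomorphism c0 (T ` c0) T S"
    using assms unfolding contains_c0_def by blast
  have c0_zero: "0 \<in> c0" by (simp add: c0_def)
  have c0_add: "x + y \<in> c0" if "x \<in> c0" "y \<in> c0" for x y
    using that tendsto_add[of "apply_bcontfun x" 0 sequentially "apply_bcontfun y" 0]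
    by (simp add: c0_def plus_bcontfun.rep_eq)
  have c0_scale: "r *\<^sub>R x \<in> c0" if "x \<in> c0" for r x
    using that tendsto_scaleR[of "\<lambda>_. r" r sequentially "apply_bcontfun x" 0]
    by (simp add: c0_def scaleR_bcontfun.rep_eq)
  have T_zero: "T 0 = 0" using scale[OF c0_zero, of 0] by simp
  have S_T: "S (T x) = x" if "x \<in> c0" for x
    using hom that by (simp add: homeomorphism_def)
  have S_zero: "S 0 = 0" using S_T[OF c0_zero] T_zero by simp
  define e :: "nat \<Rightarrow> nat \<Rightarrow>\<^sub>C real" where "e i = Bcontfun (\<lambda>k. if k = i then 1 else 0)" for i
  have e_apply: "apply_bcontfun (e i) k = (if k = i then 1 else 0)" for i k
  proof -
    have "(\<lambda>k. if k = i then 1 else 0 :: real) \<in> bcontfun"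
      by (rule bcontfun_normI[of _ 1]) auto
    then show ?thesis by (simp add: e_def Bcontfun_inverse)
  qed
  have e_c0: "e i \<in> c0" for i
    unfolding c0_def mem_Collect_eq
    by (rule tendsto_eventually)
      (use eventually_gt_at_top[of i] in \<open>eventually_elim, auto simp: e_apply\<close>)
  have norm_e: "1 \<le> norm (e i)" for i
    using norm_bounded[of "e i" i] by (simp add: e_apply)
  have comb: "(\<Sum>i=m..<n. a i *\<^sub>R e i) \<in> c0 \<and>
      T (\<Sum>i=m..<n. a i *\<^sub>R e i) = (\<Sum>i=m..<n. a i *\<^sub>R T (e i)) \<and>
      (\<forall>k. apply_bcontfun (\<Sum>i=m..<n. a i *\<^sub>R e i) k = (if k \<in> {m..<n} then a k else 0))" for a m n
  proof (induction n)
    case 0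
    then show ?case by (simp add: c0_zero T_zero zero_bcontfun.rep_eq)
  next
    case (Suc n)
    then show ?case
      by (cases "m \<le> n")
        (auto simp: c0_add c0_scale e_c0 add scale plus_bcontfun.rep_eq scaleR_bcontfun.rep_eq
          e_apply c0_zero T_zero)
  qed
  have norm_comb: "norm (\<Sum>i=m..<n. a i *\<^sub>R e i) \<le> 1" if "\<And>i. \<bar>a i\<bar> \<le> 1" for a m n
    by (rule norm_bound) (use comb that in auto)
  obtain d where d: "0 < d" "\<And>x. x \<in> c0 \<Longrightarrow> norm x < d \<Longrightarrow> norm (T x) < 1"
    using hom c0_zero T_zero unfolding homeomorphism_def continuous_on_iff
    by (metis dist_0_norm dist_commute zero_less_one)
  obtain c where c: "0 < c" "\<And>x. x \<in> c0 \<Longrightarrow> norm (T x) < c \<Longrightarrow> norm x < 1"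
  proof -
    have "continuous_on (T ` c0) S" using hom by (simp add: homeomorphism_def)
    then obtain c where "0 < c" "\<And>y. y \<in> T ` c0 \<Longrightarrow> dist y 0 < c \<Longrightarrow> dist (S y) (S 0) < 1"
      unfolding continuous_on_iff using c0_zero T_zero by (metis imageI zero_less_one)
    then have "norm x < 1" if "x \<in> c0" "norm (T x) < c" for x
      using that S_T[OF that(1)] S_zero by (metis dist_norm diff_zero imageI)
    then show thesis using \<open>0 < c\<close> that by blast
  qed
  have "norm (\<Sum>i=m..<n. a i *\<^sub>R T (e i)) \<le> 2 / d" if a: "\<And>i. \<bar>a i\<bar> \<le> 1" for a m n
  proof -
    let ?x = "\<Sum>i=m..<n. a i *\<^sub>R e i"
    have "norm ((d / 2) *\<^sub>R ?x) \<le> d / 2 * 1"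
      unfolding norm_scaleR using d(1) by (intro mult_mono norm_comb a) auto
    then have "norm (T ((d / 2) *\<^sub>R ?x)) < 1"
      using d comb[of a] by (intro d(2) c0_scale) auto
    then show ?thesis
      using d(1) scale[of ?x "d / 2"] comb[where a = a and m = m and n = n] by (simp add: field_simps)
  qed
  moreover have "c \<le> norm (T (e i))" for i
    using c(2)[OF e_c0] norm_e[of i] by (meson not_less)
  ultimately show ?thesis
    using c(1) by (intro exI[of _ "\<lambda>i. T (e i)"] exI[of _ c] exI[of _ "2 / d"]) blast
qed

section \<open>Block sequences close to the basis of \<open>c\<^sub>0\<close>\<close>

definition block_combinations :: "(nat \<Rightarrow> 'y::real_normed_vector) \<Rightarrow> nat \<Rightarrow> nat \<Rightarrow> 'y set" where
  "block_combinations v m n = {\<Sum>i=m..<n. a i *\<^sub>R v i |a. \<forall>i. \<bar>a i\<bar> \<le> 1}"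

lemma block_combinations_scale:
  assumes "x \<in> block_combinations v m n" "\<bar>r\<bar> \<le> 1"
  shows "r *\<^sub>R x \<in> block_combinations v m n"
proof -
  obtain a where "x = (\<Sum>i=m..<n. a i *\<^sub>R v i)" "\<forall>i. \<bar>a i\<bar> \<le> 1"
    using assms(1) by (auto simp: block_combinations_def)
  then have "r *\<^sub>R x = (\<Sum>i=m..<n. (r * a i) *\<^sub>R v i)" "\<forall>i. \<bar>r * a i\<bar> \<le> 1"
    using assms(2) by (auto simp: scaleR_right.sum abs_mult intro: mult_le_one)
  then show ?thesis unfolding block_combinations_def
    by (intro CollectI exI[of _ "\<lambda>i. r * a i"]) auto
qed

lemma block_combinations_add:
  assumes "x \<in> block_combinations v l m" "y \<in> block_combinations v m n" "l \<le> m" "m \<le> n"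
  shows "x + y \<in> block_combinations v l n"
proof -
  obtain a where a: "x = (\<Sum>i=l..<m. a i *\<^sub>R v i)" "\<forall>i. \<bar>a i\<bar> \<le> 1"
    using assms(1) by (auto simp: block_combinations_def)
  obtain b where b: "y = (\<Sum>i=m..<n. b i *\<^sub>R v i)" "\<forall>i. \<bar>b i\<bar> \<le> 1"
    using assms(2) by (auto simp: block_combinations_def)
  let ?c = "\<lambda>i. if i < m then a i else b i"
  have "x + y = (\<Sum>i=l..<m. ?c i *\<^sub>R v i) + (\<Sum>i=m..<n. ?c i *\<^sub>R v i)"
    by (simp add: a(1) b(1))
  also have "\<dots> = (\<Sum>i=l..<n. ?c i *\<^sub>R v i)"
    using assms(3,4) by (rule sum.atLeastLessThan_concat)
  finally show ?thesis using a(2) b(2) unfolding block_combinations_def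
    by (intro CollectI exI[of _ ?c]) auto
qed

text \<open>
  James's distortion argument for \<open>c\<^sub>0\<close>. The supremum \<open>K m\<close> of the norms of combinations supported
  beyond \<open>m\<close> decreases to a positive limit, so far out all values \<open>K m\<close> nearly agree. Successive
  blocks that nearly attain \<open>K m\<close> are then almost as long as the supremum over all their
  combinations, since such a combination is again supported beyond the starting point. Dividing by
  that supremum gives the normalised sequence.
\<close>

lemma james_block_sequence:
  fixes v :: "nat \<Rightarrow> 'y::real_normed_vector"
  assumes "0 < c" "\<forall>i. c \<le> norm (v i)"
    and bound: "\<forall>a m n. (\<forall>i. \<bar>a i\<bar> \<le> 1) \<longrightarrow> norm (\<Sum>i=m..<n. a i *\<^sub>R v i) \<le> C"
    and "0 < t" "t < 1"
  shows "\<exists>u :: nat \<Rightarrow> 'y. (\<forall>k. t < norm (u k)) \<and>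
    (\<forall>s p q. (\<forall>k. \<bar>s k\<bar> \<le> 1) \<longrightarrow> norm (\<Sum>k=p..<q. s k *\<^sub>R u k) \<le> 1)"
proof -
  define P where "P m = (\<Union>n\<in>{m..}. block_combinations v m n)" for m
  define K where "K m = (SUP x\<in>P m. norm x)" for m
  have v_P: "v m \<in> P m" for m
    unfolding P_def block_combinations_def
    by (auto intro!: bexI[of _ "Suc m"] exI[of _ "\<lambda>_. 1"])
  have bdd: "bdd_above (norm ` P m)" for m
    by (rule bdd_aboveI2[of _ _ C]) (auto simp: P_def block_combinations_def bound)
  have norm_le_K: "norm x \<le> K m" if "x \<in> P m" for x m
    unfolding K_def by (rule cSUP_upper[OF that bdd])
  have c_le_K: "c \<le> K m" for m
    using assms(2) norm_le_K[OF v_P, of m] by (meson order_trans)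
  have bdd_K: "bdd_below (range K)"
    using c_le_K by (rule bdd_belowI2)
  define k where "k = (INF m. K m)"
  have "c \<le> k"
    unfolding k_def by (rule cINF_greatest) (auto simp: c_le_K)
  then have "0 < k" using assms(1) by linarith
  then have "k < k / t" using assms(4,5) by (simp add: field_simps)
  then obtain N where "K N < k / t"
    unfolding k_def using bdd_K by (auto simp: cINF_less_iff)
  then have N: "t * K N < k" using assms(4) by (simp add: field_simps)
  \<comment> \<open>From \<open>N\<close> on, every tail contains a block of norm above \<open>t * K N\<close>, because \<open>K\<close> never drops
      below its infimum \<open>k > t * K N\<close>.\<close>
  have "\<exists>x n. m \<le> n \<and> x \<in> block_combinations v m n \<and> t * K N < norm x" for m
  proof -
    have "t * K N < K m"
      using N cINF_lower[OF bdd_K, of m] by (simp add: k_def)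
    then show ?thesis
      unfolding K_def using bdd v_P[of m] by (subst (asm) less_cSUP_iff) (fastforce simp: P_def)+
  qed
  then obtain w next_start where block: "\<And>m. m \<le> next_start m"
      "\<And>m. w m \<in> block_combinations v m (next_start m)" "\<And>m. t * K N < norm (w m)"
    by metis
  define start where "start k = (next_start ^^ k) N" for k
  have start_Suc: "start (Suc k) = next_start (start k)" for k
    by (simp add: start_def)
  have start_mono: "mono start"
    by (rule mono_iff_le_Suc[THEN iffD2]) (simp add: start_Suc block(1))
  have sum_mem: "(\<Sum>k=p..<q. s k *\<^sub>R w (start k)) \<in> block_combinations v (start p) (start q)"
    if s: "\<And>k. \<bar>s k\<bar> \<le> 1" and "p \<le> q" for s p q
    using \<open>p \<le> q\<close>
  proof (induction q rule: dec_induct)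
    case base
    show ?case by (auto simp: block_combinations_def intro!: exI[of _ "\<lambda>_. 0"])
  next
    case (step q)
    have "(\<Sum>k=p..<q. s k *\<^sub>R w (start k)) + s q *\<^sub>R w (start q)
            \<in> block_combinations v (start p) (start (Suc q))"
      using step.IH
    proof (rule block_combinations_add)
      show "s q *\<^sub>R w (start q) \<in> block_combinations v (start q) (start (Suc q))"
        unfolding start_Suc using block(2) s by (rule block_combinations_scale)
    qed (use start_mono step.hyps in \<open>auto simp: monoD\<close>)
    then show ?case using step.hyps by simp
  qed
  have "0 < K N" using assms(1) c_le_K[of N] by linarith
  have "norm (\<Sum>k=p..<q. s k *\<^sub>R ((1 / K N) *\<^sub>R w (start k))) \<le> 1"
    if s: "\<And>k. \<bar>s k\<bar> \<le> 1" for s p q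
  proof (cases "p \<le> q")
    case True
    let ?x = "\<Sum>k=p..<q. s k *\<^sub>R w (start k)"
    \<comment> \<open>Padding with zero coefficients moves the sum to the starting index \<open>start 0 = N\<close>, so that
        \<open>K N\<close> bounds it whatever \<open>p\<close> is.\<close>
    have "(\<Sum>k=0..<p. 0 *\<^sub>R w (start k)) + ?x = (\<Sum>k=0..<q. (if k < p then 0 else s k) *\<^sub>R w (start k))"
      using True by (subst sum.atLeastLessThan_concat[of 0 p q, symmetric]) auto
    also have "\<dots> \<in> block_combinations v (start 0) (start q)"
      by (rule sum_mem) (use s in auto)
    finally have "?x \<in> P N"
      using monoD[OF start_mono, of 0 q] by (auto simp: P_def start_def)
    then have "norm ?x \<le> K N" by (rule norm_le_K)
    moreover have "(\<Sum>k=p..<q. s k *\<^sub>R ((1 / K N) *\<^sub>R w (start k))) = (1 / K N) *\<^sub>R ?x"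
      by (simp add: scaleR_right.sum mult.commute)
    ultimately show ?thesis using \<open>0 < K N\<close> by simp
  qed auto
  moreover have "t < norm ((1 / K N) *\<^sub>R w (start k))" for k
    using block(3)[of "start k"] \<open>0 < K N\<close> by (simp add: field_simps)
  ultimately show ?thesis
    by (intro exI[of _ "\<lambda>k. (1 / K N) *\<^sub>R w (start k)"]) blast
qed

section \<open>Separability forces a signed series without a near centre\<close>

text \<open>
  Where two sign choices differ for the first time, at \<open>k\<close>, their \<open>k\<close>-th partial sums differ by
  \<open>\<plusminus> 2 u k\<close>. A point within \<open>r\<close> of all partial sums of one choice is therefore more than
  \<open>2 * (t - r)\<close> away from such a point for the other. If every choice had such a point, the
  subsets of the natural numbers, which encode the signs, would inject into a countable dense set.
  Comparing partial sums directly takes the place of extending the coordinate functionals of \<open>u\<close>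
  to the whole space.
\<close>

lemma separable_sign_series_no_center:
  fixes u :: "nat \<Rightarrow> 'y::real_normed_vector"
  assumes sep: "separable_space (euclidean :: 'y topology)"
    and u: "\<forall>k. t < norm (u k)" and "r < t"
  obtains s :: "nat \<Rightarrow> real" where "\<And>i. \<bar>s i\<bar> = 1"
    "\<And>z. \<exists>n. r < dist z (\<Sum>i\<le>n. s i *\<^sub>R u i)"
proof (rule ccontr)
  assume "\<not> thesis"
  note no_signs = this
  define sg :: "nat set \<Rightarrow> nat \<Rightarrow> real" where "sg A i = (if i \<in> A then 1 else -1)" for A i
  have "\<exists>z. \<forall>n. dist z (\<Sum>i\<le>n. sg A i *\<^sub>R u i) \<le> r" for A
    using no_signs that[of "sg A"] by (force simp: sg_def not_less)
  then obtain z where z: "\<And>A n. dist (z A) (\<Sum>i\<le>n. sg A i *\<^sub>R u i) \<le> r"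
    by metis
  have far: "2 * (t - r) < dist (z A) (z B)" if "A \<noteq> B" for A B
  proof -
    define k where "k = (LEAST k. (k \<in> A) \<noteq> (k \<in> B))"
    have k: "(k \<in> A) \<noteq> (k \<in> B)" "\<And>i. i < k \<Longrightarrow> (i \<in> A) = (i \<in> B)"
      using that LeastI_ex[of "\<lambda>k. (k \<in> A) \<noteq> (k \<in> B)"] not_less_Least
      unfolding k_def by blast+
    have "(\<Sum>i\<le>k. sg A i *\<^sub>R u i) - (\<Sum>i\<le>k. sg B i *\<^sub>R u i) = (sg A k - sg B k) *\<^sub>R u k"
      using k(2) by (simp add: sg_def scaleR_diff_left flip: lessThan_Suc_atMost)
    moreover have "\<bar>sg A k - sg B k\<bar> = 2" using k(1) by (auto simp: sg_def)
    ultimately have "dist (\<Sum>i\<le>k. sg A i *\<^sub>R u i) (\<Sum>i\<le>k. sg B i *\<^sub>R u i) = 2 * norm (u k)"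
      by (simp add: dist_norm)
    moreover have "dist (\<Sum>i\<le>k. sg A i *\<^sub>R u i) (\<Sum>i\<le>k. sg B i *\<^sub>R u i) \<le> r + dist (z A) (z B) + r"
      using z[of A k] z[of B k] by (smt (verit) dist_commute dist_triangle)
    ultimately have "2 * norm (u k) \<le> r + dist (z A) (z B) + r" by simp
    then show ?thesis using u[rule_format, of k] by (simp add: algebra_simps)
  qed
  obtain D :: "'y set" where D: "countable D" "closure D = UNIV"
    using sep by (auto simp: separable_space_def)
  have "\<exists>d\<in>D. dist d (z A) < t - r" for A
    using D(2) \<open>r < t\<close> closure_approachable[of "z A" D] by simp
  then obtain d where d: "\<And>A. d A \<in> D" "\<And>A. dist (d A) (z A) < t - r"
    by metis
  have "inj d"
  proof (rule injI, rule ccontr)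
    fix A B assume "d A = d B" "A \<noteq> B"
    then show False
      using far[of A B] d(2)[of A] d(2)[of B] dist_triangle2[of "z A" "z B" "d A"]
      by (simp add: dist_commute)
  qed
  moreover have "countable (range d)"
    using d(1) by (intro countable_subset[OF _ D(1)]) auto
  ultimately have "countable (UNIV :: nat set set)"
    by (rule countable_image_inj_on[rotated])
  then obtain g :: "nat \<Rightarrow> nat set" where "range g = UNIV"
    by (metis UNIV_I empty_not_UNIV uncountable_def)
  then show False using Cantors_theorem[of "UNIV :: nat set"] by auto
qed

section \<open>The lower bound\<close>

theorem proposition3:
  fixes \<omega> :: "real \<Rightarrow> real"
  assumes "gauge_fun \<omega>"
    and "separable_space (euclidean :: 'y::banach topology)"
    and "contains_c0 TYPE('y)"
    and "\<not> (\<exists>B :: 'x::banach set. finite B \<and> span B = UNIV)"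
  shows "ennreal (\<omega> (kottman TYPE('x)) / \<omega> 1) \<le> lambda_gauge \<omega> TYPE('x) TYPE('y)"
  unfolding lambda_gauge_def
proof (rule Inf_greatest, clarify)
  fix L :: real
  assume "0 < L" and ext: "\<forall>(M :: 'x set) (f :: 'x \<Rightarrow> 'y). Lip_gauge \<omega> M f < \<infinity> \<longrightarrow>
    (\<exists>F. (\<forall>x\<in>M. F x = f x) \<and> Lip_gauge \<omega> UNIV F \<le> ennreal L * Lip_gauge \<omega> M f)"
  let ?K = "kottman TYPE('x)"
  have \<omega>1: "0 < \<omega> 1" using gauge_fun_pos[OF assms(1)] by simp
  show "ennreal (\<omega> ?K / \<omega> 1) \<le> ennreal L"
  proof (rule ccontr)
    assume "\<not> ?thesis"
    then have "L < \<omega> ?K / \<omega> 1" by (meson ennreal_leI not_less)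
    then have L_less: "L * \<omega> 1 < \<omega> ?K" using \<omega>1 by (simp add: field_simps)
    have "?K \<noteq> 0"
      using L_less gauge_fun_zero[OF assms(1)] mult_pos_pos[OF \<open>0 < L\<close> \<omega>1] by auto
    then have "0 < ?K" using kottman_nonneg[where 'x = 'x] by linarith
    \<comment> \<open>The supremum defining \<open>?K\<close> need not be attained; left continuity of \<open>\<omega>\<close> at \<open>?K\<close> gives a
        smaller separation \<open>k\<close> that is still large enough and is exceeded by some sequence.\<close>
    have "(\<omega> \<longlongrightarrow> \<omega> ?K) (at ?K within {0..})"
      using assms(1) \<open>0 < ?K\<close> by (auto simp: gauge_fun_def continuous_on_def)
    then have "(\<omega> \<longlongrightarrow> \<omega> ?K) (at_left ?K)"
      using \<open>0 < ?K\<close> by (simp add: at_within_interior[of ?K "{0..}"] filterlim_at_split)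
    then have "\<forall>\<^sub>F k in at_left ?K. L * \<omega> 1 < \<omega> k"
      using L_less by (rule order_tendstoD(1))
    moreover have "\<forall>\<^sub>F k in at_left ?K. k \<in> {0<..<?K}"
      using \<open>0 < ?K\<close> by (rule eventually_at_left_real)
    ultimately have "\<forall>\<^sub>F k in at_left ?K. L * \<omega> 1 < \<omega> k \<and> k \<in> {0<..<?K}"
      by (rule eventually_conj)
    then obtain k where k: "L * \<omega> 1 < \<omega> k" "0 < k" "k < ?K"
      using eventually_happens'[OF trivial_limit_at_left_real] by auto
    obtain x :: "nat \<Rightarrow> 'x" where
      x: "\<And>n. norm (x n) \<le> 1" "\<And>n m. n \<noteq> m \<Longrightarrow> k < dist (x n) (x m)"
      using less_kottmanE[OF k(3)] by blast
    have "inj x" using x(2) k(2) by (metis dist_self injI less_asym)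
    have \<omega>k: "0 < \<omega> k" using gauge_fun_pos[OF assms(1) k(2)] .
    define r where "r = L * \<omega> 1 / \<omega> k"
    have "0 < r" "r < 1" using \<open>0 < L\<close> \<omega>1 \<omega>k k(1) by (auto simp: r_def)
    then obtain t where t: "0 < t" "r < t" "t < 1" using dense[of r 1] by auto
    obtain v :: "nat \<Rightarrow> 'y" and c C where v: "0 < c" "\<forall>i. c \<le> norm (v i)"
      "\<forall>a m n. (\<forall>i. \<bar>a i\<bar> \<le> 1) \<longrightarrow> norm (\<Sum>i=m..<n. a i *\<^sub>R v i) \<le> C"
      using contains_c0_unit_vectors[OF assms(3)] by (elim exE conjE) (rule that)
    obtain u :: "nat \<Rightarrow> 'y" where u: "\<forall>k. t < norm (u k)"
      "\<forall>s p q. (\<forall>k. \<bar>s k\<bar> \<le> 1) \<longrightarrow> norm (\<Sum>k=p..<q. s k *\<^sub>R u k) \<le> 1"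
      using james_block_sequence[OF v t(1,3)] by (elim exE conjE) (rule that)
    obtain s :: "nat \<Rightarrow> real" where s: "\<And>i. \<bar>s i\<bar> = 1"
      "\<And>z. \<exists>n. r < dist z (\<Sum>i\<le>n. s i *\<^sub>R u i)"
      using separable_sign_series_no_center[OF assms(2) u(1) t(2)] by blast
    define y where "y n = (\<Sum>i\<le>n. s i *\<^sub>R u i)" for n
    have "dist (y m) (y n) \<le> 1" if "m \<le> n" for m n
    proof -
      have "y n = y m + (\<Sum>i=Suc m..<Suc n. s i *\<^sub>R u i)"
        using that sum.atLeastLessThan_concat[of 0 "Suc m" "Suc n" "\<lambda>i. s i *\<^sub>R u i"]
        by (simp add: y_def atLeast0LessThan flip: lessThan_Suc_atMost)
      moreover have "norm (\<Sum>i=Suc m..<Suc n. s i *\<^sub>R u i) \<le> 1"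
        by (rule u(2)[rule_format]) (simp add: s(1))
      ultimately show ?thesis by (simp add: dist_norm norm_minus_commute)
    qed
    then have y_dist: "dist (y m) (y n) \<le> 1" for m n
      by (metis dist_commute nle_le)
    define f where "f = y \<circ> inv x"
    have f_x: "f (x n) = y n" for n
      using \<open>inj x\<close> by (simp add: f_def)
    have lip: "Lip_gauge \<omega> (range x) f \<le> ennreal (1 / \<omega> k)"
    proof (subst Lip_gauge_le_iff[OF assms(1)], use \<omega>k in simp, clarify)
      fix m n
      show "dist (f (x m)) (f (x n)) \<le> 1 / \<omega> k * \<omega> (dist (x m) (x n))"
      proof (cases "m = n")
        case False
        then have "\<omega> k \<le> \<omega> (dist (x m) (x n))"
          using x(2)[of m n] k(2) by (intro gauge_fun_mono[OF assms(1)]) auto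
        then have "1 \<le> 1 / \<omega> k * \<omega> (dist (x m) (x n))" using \<omega>k by simp
        then show ?thesis using y_dist[of m n] by (simp add: f_x)
      qed (simp add: gauge_fun_zero[OF assms(1)])
    qed
    then have "Lip_gauge \<omega> (range x) f < \<infinity>"
      by (simp add: le_less_trans)
    then obtain F where F: "\<And>n. F (x n) = y n"
      "Lip_gauge \<omega> UNIV F \<le> ennreal L * Lip_gauge \<omega> (range x) f"
      using ext f_x by (metis rangeI)
    note F(2)
    also have "ennreal L * Lip_gauge \<omega> (range x) f \<le> ennreal L * ennreal (1 / \<omega> k)"
      using lip by (rule mult_left_mono) simp
    also have "\<dots> = ennreal (L / \<omega> k)"
      using \<open>0 < L\<close> \<omega>k by (simp flip: ennreal_mult)
    finally have lip_F: "dist (F a) (F b) \<le> L / \<omega> k * \<omega> (dist a b)" for a b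
      using \<open>0 < L\<close> \<omega>k by (subst (asm) Lip_gauge_le_iff[OF assms(1)]) auto
    have "dist (F 0) (y n) \<le> r" for n
    proof -
      have "dist (F 0) (y n) \<le> L / \<omega> k * \<omega> (norm (x n))"
        using lip_F[of 0 "x n"] by (simp add: F(1))
      also have "\<dots> \<le> L / \<omega> k * \<omega> 1"
        using \<open>0 < L\<close> \<omega>k x(1) by (intro mult_left_mono gauge_fun_mono[OF assms(1)]) auto
      finally show ?thesis by (simp add: r_def)
    qed
    then show False using s(2)[of "F 0"] by (simp add: y_def not_less[symmetric])
  qed
qed

end
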